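(* None of the following graphs is realizable: $K_5$; $K_{3,2}$; $K_7\setminus C_5$; $K_7\setminus H_6$; $K_8\setminus H_7$.
   Context: Every directed line in $\mathbb{R}^3$ can be written $L=\mathbb{R}x+y$ with $x$ a unit vector (its direction) and $y\in\mathbb{R}^3$. For two non-parallel directed lines $L=\mathbb{R}x+y$, $L'=\mathbb{R}x'+y'$ that are not coplanar, their chirality is $\varepsilon(L,L')=\operatorname{sign}\langle x\times x',\,y-y'\rangle\in\{\pm1\}$ (this is independent of the choice of base points and symmetric in $L,L'$). A finite simple graph $G$ is called realizable if there exist directed lines $\{L_v\}_{v\in V(G)}$ in $\mathbb{R}^3$ such that no two of them are parallel, the distance between any two distinct lines is exactly $1$, and for distinct $v,w$, $\varepsilon(L_v,L_w)=+1$ if and only if $vw\in E(G)$. $C_5$ is the 5-cycle. $H_6$ is the graph on vertices $1,\dots,6$ with edges $12,23,34,45,51,26,56$. $H_7$ is the graph on vertices $1,\dots,7$ with edges $12,23,31,14,25,36,47,57,67$. For a graph $H$ on $m\le n$ vertices, $K_n\setminus H$ denotes the graph on $n$ vertices obtained from the complete graph $K_n$ by identifying $V(H)$ with $m$ of its vertices and deleting the edges of $H$. $K_{3,2}$ is the complete bipartite graph with parts of sizes 3 and 2. *)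

theory Defs
  imports "HOL-Analysis.Analysis"
begin

section \<open>Finite simple graphs\<close>

text \<open>A graph is a pair of its vertex set and its set of edges, an edge being a set of two vertices.\<close>

type_synonym 'a graph = "'a set \<times> 'a set set"

definition all_pairs :: "'a set \<Rightarrow> 'a set set" where
  "all_pairs V = {{u, v} | u v. u \<in> V \<and> v \<in> V \<and> u \<noteq> v}"

definition simple_graph :: "'a graph \<Rightarrow> bool" where
  "simple_graph G \<longleftrightarrow> finite (fst G) \<and> snd G \<subseteq> all_pairs (fst G)"

definition complete_graph :: "nat \<Rightarrow> nat graph" where
  "complete_graph n = ({1..n}, all_pairs {1..n})"

definition complete_bipartite_graph :: "nat \<Rightarrow> nat \<Rightarrow> nat graph" where
  "complete_bipartite_graph m n =
     ({1..m + n}, {{u, v} | u v. u \<in> {1..m} \<and> v \<in> {m + 1..m + n}})"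

definition cycle_graph :: "nat \<Rightarrow> nat graph" where
  "cycle_graph n = ({1..n}, {{i, i mod n + 1} | i. i \<in> {1..n}})"

definition H6 :: "nat graph" where
  "H6 = ({1..6}, {{1,2}, {2,3}, {3,4}, {4,5}, {5,1}, {2,6}, {5,6}})"

definition H7 :: "nat graph" where
  "H7 = ({1..7}, {{1,2}, {2,3}, {3,1}, {1,4}, {2,5}, {3,6}, {4,7}, {5,7}, {6,7}})"

text \<open>
  For a graph \<open>H\<close> with vertex set \<open>{1..m}\<close>, \<open>m \<le> n\<close>, this is \<open>K\<^sub>n\<close> with the edges of \<open>H\<close> deleted;
  \<open>V(H)\<close> is identified with the first \<open>m\<close> vertices of \<open>K\<^sub>n\<close>. Every other identification
  gives an isomorphic graph, and realizability (defined below) is invariant under isomorphism,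
  see \<open>realizable_image_iff\<close>.
\<close>

definition complete_graph_minus :: "nat \<Rightarrow> nat graph \<Rightarrow> nat graph" where
  "complete_graph_minus n H =
     (fst (complete_graph n), snd (complete_graph n) - snd H)"

lemma all_pairs_iff: "{u, v} \<in> all_pairs V \<longleftrightarrow> u \<in> V \<and> v \<in> V \<and> u \<noteq> v"
  by (auto simp: all_pairs_def doubleton_eq_iff)

lemma simple_graph_complete_graph: "simple_graph (complete_graph n)"
  by (simp add: simple_graph_def complete_graph_def)

lemma simple_graph_complete_graph_minus: "simple_graph (complete_graph_minus n H)"
  by (auto simp: simple_graph_def complete_graph_def complete_graph_minus_def)

lemma simple_graph_complete_bipartite_graph: "simple_graph (complete_bipartite_graph m n)"
proof -
  have "{u, v} \<in> all_pairs {1..m + n}" if "u \<in> {1..m}" "v \<in> {m + 1..m + n}" for u v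
    using that unfolding all_pairs_iff by simp
  then show ?thesis
    unfolding simple_graph_def complete_bipartite_graph_def by auto
qed

lemma cycle_graph_5:
  "cycle_graph 5 = ({1..5}, {{1,2}, {2,3}, {3,4}, {4,5}, {5,1}})"
proof -
  have "{1..5::nat} = {1,2,3,4,5}" by auto
  then show ?thesis
    by (simp only: cycle_graph_def Setcompr_eq_image) (simp flip: numeral_2_eq_2)
qed

lemma simple_graph_cycle_graph_5: "simple_graph (cycle_graph 5)"
  by (simp add: cycle_graph_5 simple_graph_def all_pairs_iff)

lemma simple_graph_H6: "simple_graph H6"
  by (simp add: H6_def simple_graph_def all_pairs_iff)

lemma simple_graph_H7: "simple_graph H7"
  by (simp add: H7_def simple_graph_def all_pairs_iff)


section \<open>Directed lines in three-space\<close>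

text \<open>A directed line is given by its unit direction vector and a base point on it.\<close>

type_synonym dline = "(real^3) \<times> (real^3)"

definition directed_line :: "dline \<Rightarrow> bool" where
  "directed_line L \<longleftrightarrow> norm (fst L) = 1"

definition line_points :: "dline \<Rightarrow> (real^3) set" where
  "line_points L = {t *\<^sub>R fst L + snd L | t. True}"

definition parallel_lines :: "dline \<Rightarrow> dline \<Rightarrow> bool" where
  "parallel_lines L L' \<longleftrightarrow> (\<exists>c. fst L' = c *\<^sub>R fst L)"

definition chirality :: "dline \<Rightarrow> dline \<Rightarrow> real" where
  "chirality L L' = sgn (cross3 (fst L) (fst L') \<bullet> (snd L - snd L'))"

lemma chirality_sym: "chirality L L' = chirality L' L"
proof -
  have "cross3 (fst L) (fst L') \<bullet> (snd L - snd L') = cross3 (fst L') (fst L) \<bullet> (snd L' - snd L)"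
    by (subst cross_skew) (simp add: inner_diff_right)
  then show ?thesis
    by (simp add: chirality_def)
qed

lemma chirality_base_point:
  assumes "p \<in> line_points L" "q \<in> line_points L'"
  shows "chirality (fst L, p) (fst L', q) = chirality L L'"
proof -
  obtain s t where "p = s *\<^sub>R fst L + snd L" "q = t *\<^sub>R fst L' + snd L'"
    using assms by (auto simp: line_points_def)
  then show ?thesis
    by (simp add: chirality_def inner_diff_right inner_add_right dot_cross_self)
qed

text \<open>
  Lines at distance 1 do not meet, so for two non-parallel lines at distance 1 the chirality
  is 1 or -1.
\<close>

definition realizable :: "'a graph \<Rightarrow> bool" where
  "realizable G \<longleftrightarrow>
     (\<exists>L :: 'a \<Rightarrow> dline.
        (\<forall>v\<in>fst G. directed_line (L v)) \<and>
        (\<forall>v\<in>fst G. \<forall>w\<in>fst G. v \<noteq> w \<longrightarrow>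
           \<not> parallel_lines (L v) (L w) \<and>
           setdist (line_points (L v)) (line_points (L w)) = 1 \<and>
           (chirality (L v) (L w) = 1 \<longleftrightarrow> {v, w} \<in> snd G)))"

lemma realizable_image_iff:
  assumes G: "simple_graph (V, E)" and f: "inj_on f V"
  shows "realizable (f ` V, (`) f ` E) \<longleftrightarrow> realizable (V, E)"
proof -
  have E: "{f v, f w} \<in> (`) f ` E \<longleftrightarrow> {v, w} \<in> E" if "v \<in> V" "w \<in> V" for v w
  proof
    assume "{f v, f w} \<in> (`) f ` E"
    then obtain e where e: "e \<in> E" "f ` {v, w} = f ` e" by auto
    moreover have "e \<subseteq> V"
      using G e by (auto simp: simple_graph_def all_pairs_def)
    ultimately have "{v, w} = e"
      using that e inj_on_image_eq_iff[OF f, of "{v, w}" e] by blast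
    with e show "{v, w} \<in> E" by simp
  next
    assume "{v, w} \<in> E"
    then have "f ` {v, w} \<in> (`) f ` E" by (rule imageI)
    then show "{f v, f w} \<in> (`) f ` E" by simp
  qed
  show ?thesis
  proof
    assume "realizable (f ` V, (`) f ` E)"
    then obtain L where L: "\<forall>v\<in>f ` V. directed_line (L v)"
      "\<forall>v\<in>f ` V. \<forall>w\<in>f ` V. v \<noteq> w \<longrightarrow> \<not> parallel_lines (L v) (L w) \<and>
         setdist (line_points (L v)) (line_points (L w)) = 1 \<and>
         (chirality (L v) (L w) = 1 \<longleftrightarrow> {v, w} \<in> (`) f ` E)"
      by (auto simp: realizable_def)
    show "realizable (V, E)"
      unfolding realizable_def fst_conv snd_conv
    proof (intro exI[of _ "L \<circ> f"] conjI ballI impI)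
      fix v w assume vw: "v \<in> V" "w \<in> V" "v \<noteq> w"
      then have "f v \<noteq> f w" using f by (auto dest: inj_onD)
      then show "\<not> parallel_lines ((L \<circ> f) v) ((L \<circ> f) w)"
        "setdist (line_points ((L \<circ> f) v)) (line_points ((L \<circ> f) w)) = 1"
        "chirality ((L \<circ> f) v) ((L \<circ> f) w) = 1 \<longleftrightarrow> {v, w} \<in> E"
        using L(2) vw E[OF vw(1,2)] by simp_all
    qed (use L in auto)
  next
    assume "realizable (V, E)"
    then obtain L where L: "\<forall>v\<in>V. directed_line (L v)"
      "\<forall>v\<in>V. \<forall>w\<in>V. v \<noteq> w \<longrightarrow> \<not> parallel_lines (L v) (L w) \<and>
         setdist (line_points (L v)) (line_points (L w)) = 1 \<and>
         (chirality (L v) (L w) = 1 \<longleftrightarrow> {v, w} \<in> E)"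
      by (auto simp: realizable_def)
    define M where "M = L \<circ> inv_into V f"
    have M: "M (f v) = L v" if "v \<in> V" for v
      using that f by (simp add: M_def)
    have "\<forall>v\<in>f ` V. directed_line (M v)"
      using L M by simp
    moreover have "\<not> parallel_lines (M (f v)) (M (f w)) \<and>
         setdist (line_points (M (f v))) (line_points (M (f w))) = 1 \<and>
         (chirality (M (f v)) (M (f w)) = 1 \<longleftrightarrow> {f v, f w} \<in> (`) f ` E)"
      if "v \<in> V" "w \<in> V" "f v \<noteq> f w" for v w
    proof -
      have "v \<noteq> w" using that by auto
      then show ?thesis
        using L(2) that(1,2) unfolding M[OF that(1)] M[OF that(2)] E[OF that(1,2)] by blast
    qed
    ultimately show "realizable (f ` V, (`) f ` E)"
      unfolding realizable_def fst_conv snd_conv by (intro exI[of _ M]) blast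
  qed
qed

end

theory Submission
  imports Defs
begin

text \<open>
  Let \<open>x\<^sub>v\<close> be the directions, \<open>s\<^sub>v\<^sub>w = norm (x\<^sub>v \<times> x\<^sub>w)\<close> the sines of the angles and \<open>\<epsilon>\<close> the chiralities.
  Distance 1 means that \<open>\<epsilon>\<^sub>v\<^sub>w s\<^sub>v\<^sub>w\<close> is the reciprocal product of the two lines, a form on \<open>\<real>\<^sup>6\<close> for which
  the quadratic form of \<open>(\<epsilon>\<^sub>v\<^sub>w s\<^sub>v\<^sub>w)\<close> vanishes at every \<open>u\<close> with \<open>\<Sum>\<^sub>v u\<^sub>v x\<^sub>v = 0\<close>. On the other hand
  \<open>s\<^sub>v\<^sub>w = 1 - P\<^sub>v\<^sub>w\<close> with \<open>P\<close> positive definite, so the quadratic form of \<open>s\<close> is negative at every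
  \<open>u \<noteq> 0\<close> with \<open>\<Sum>\<^sub>v u\<^sub>v = 0\<close>. If \<open>H\<close> is the graph of the pairs of chirality -1, the sum of
  \<open>s\<^sub>v\<^sub>w u\<^sub>v u\<^sub>w\<close> over the edges of \<open>H\<close> is therefore negative whenever \<open>u \<noteq> 0\<close> satisfies these four linear
  equations, and a five-dimensional space of \<open>u\<close> on which that sum is nonnegative is contradictory.
  Such a space exists for \<open>K\<^sub>5\<close>, \<open>K\<^sub>7 - C\<^sub>5\<close> and \<open>K\<^sub>8 - H\<^sub>7\<close>. Reversing lines and reflecting reduces \<open>K\<^sub>3\<^sub>,\<^sub>2\<close> to
  \<open>K\<^sub>5\<close>, and \<open>K\<^sub>7 - H\<^sub>6\<close> to \<open>K\<^sub>7 - C\<^sub>5\<close>.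
\<close>

section \<open>The sine kernel of a family of directions\<close>

text \<open>The coefficient of \<open>z ^ Suc k\<close> in the power series of
  \<open>1 - sqrt (1 - z)\<close>, whose constant term vanishes.\<close>

definition sqrt_coeff :: "nat \<Rightarrow> real" where
  "sqrt_coeff k = (- 1) ^ k * ((1/2) gchoose Suc k)"

lemma sqrt_coeff_pos: "0 < sqrt_coeff k"
proof (induction k)
  case 0
  then show ?case by (simp add: sqrt_coeff_def)
next
  case (Suc k)
  have "sqrt_coeff (Suc k) = sqrt_coeff k * ((k + 1/2) / (k + 2))"
    by (simp add: sqrt_coeff_def gbinomial_prod_rev field_simps)
  with Suc show ?case by simp
qed

lemma sqrt_coeff_sums:
  assumes "0 \<le> z" "z < 1"
  shows "(\<lambda>k. sqrt_coeff k * z ^ Suc k) sums (1 - sqrt (1 - z))"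
proof -
  have "(\<lambda>n. ((1/2) gchoose n) * (- z) ^ n) sums sqrt (1 + - z)"
    by (rule sqrt_series) (use assms in simp)
  then have "(\<lambda>n. ((1/2) gchoose Suc n) * (- z) ^ Suc n) sums (sqrt (1 - z) - 1)"
    by (subst sums_Suc_iff) simp
  then have "(\<lambda>n. - (((1/2) gchoose Suc n) * (- z) ^ Suc n)) sums - (sqrt (1 - z) - 1)"
    by (rule sums_minus)
  moreover have "- (((1/2) gchoose Suc n) * (- z) ^ Suc n) = sqrt_coeff n * z ^ Suc n" for n
    by (simp add: sqrt_coeff_def power_minus[of z])
  ultimately show ?thesis by (simp only: minus_diff_eq)
qed

text \<open>For \<open>z < 1\<close> the partial sums stay below the full sum
  \<open>1 - sqrt (1 - z)\<close>; then \<open>z\<close> tends to 1 from the left. This controls the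
  diagonal of the kernel, where \<open>z = 1\<close>.\<close>

lemma sum_sqrt_coeff_le_1: "(\<Sum>k<N. sqrt_coeff k) \<le> 1"
proof -
  have "((\<lambda>z. \<Sum>k<N. sqrt_coeff k * z ^ Suc k) \<longlongrightarrow> (\<Sum>k<N. sqrt_coeff k * 1 ^ Suc k)) (at_left (1::real))"
    by (intro tendsto_intros)
  moreover have "\<forall>\<^sub>F z in at_left (1::real). (\<Sum>k<N. sqrt_coeff k * z ^ Suc k) \<le> 1"
    unfolding eventually_at_left_field
  proof (intro exI[of _ 0] conjI allI impI)
    fix z :: real assume z: "0 < z" "z < 1"
    note s = sqrt_coeff_sums[of z]
    have "(\<Sum>k<N. sqrt_coeff k * z ^ Suc k) \<le> (\<Sum>k. sqrt_coeff k * z ^ Suc k)"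
      using z s by (intro sum_le_suminf) (auto simp: sums_iff less_imp_le sqrt_coeff_pos)
    also have "\<dots> = 1 - sqrt (1 - z)"
      using z s by (simp add: sums_iff)
    also have "\<dots> \<le> 1"
      using z by simp
    finally show "(\<Sum>k<N. sqrt_coeff k * z ^ Suc k) \<le> 1" .
  qed simp
  ultimately have "(\<Sum>k<N. sqrt_coeff k * 1 ^ Suc k) \<le> 1"
    by (rule tendsto_upperbound) simp
  then show ?thesis by simp
qed

text \<open>Expanding one factor \<open>x i \<bullet> x j\<close> over the basis gives a sum of
  forms of the previous power with weights \<open>u i * (x i \<bullet> b)\<close>; hence the
  induction over all \<open>u\<close>.\<close>

lemma sum_inner_power_nonneg:
  fixes x :: "'i \<Rightarrow> 'b::euclidean_space"
  shows "0 \<le> (\<Sum>i\<in>V. \<Sum>j\<in>V. u i * u j * (x i \<bullet> x j) ^ m)"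
proof (induction m arbitrary: u)
  case 0
  have "(\<Sum>i\<in>V. \<Sum>j\<in>V. u i * u j) = (\<Sum>i\<in>V. u i)\<^sup>2"
    by (simp add: power2_eq_square sum_product)
  then show ?case by simp
next
  case (Suc m)
  have "u i * u j * (x i \<bullet> x j) ^ Suc m =
      (\<Sum>b\<in>Basis. (u i * (x i \<bullet> b)) * (u j * (x j \<bullet> b)) * (x i \<bullet> x j) ^ m)" for i j
  proof -
    have "u i * u j * (x i \<bullet> x j) ^ Suc m =
        u i * u j * (\<Sum>b\<in>Basis. (x i \<bullet> b) * (x j \<bullet> b)) * (x i \<bullet> x j) ^ m"
      by (simp flip: euclidean_inner)
    then show ?thesis
      by (simp only: sum_distrib_left sum_distrib_right) (simp only: mult_ac)
  qed
  then have "(\<Sum>i\<in>V. \<Sum>j\<in>V. u i * u j * (x i \<bullet> x j) ^ Suc m) =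
      (\<Sum>i\<in>V. \<Sum>j\<in>V. \<Sum>b\<in>Basis. (u i * (x i \<bullet> b)) * (u j * (x j \<bullet> b)) * (x i \<bullet> x j) ^ m)"
    by (simp only:)
  also have "\<dots> = (\<Sum>b\<in>Basis. \<Sum>i\<in>V. \<Sum>j\<in>V. (u i * (x i \<bullet> b)) * (u j * (x j \<bullet> b)) * (x i \<bullet> x j) ^ m)"
    by (subst (2) sum.swap) (subst sum.swap, rule refl)
  also have "0 \<le> \<dots>"
    by (intro sum_nonneg Suc)
  finally show ?case .
qed

text \<open>
  Schoenberg-type positivity: \<open>1 - sqrt (1 - c\<^sup>2)\<close> is a power series in \<open>c\<^sup>2\<close> with positive
  coefficients, and Hadamard powers of a Gram matrix are positive semidefinite. Strictness
  holds because high Hadamard powers converge to the identity matrix.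
\<close>

lemma sine_kernel_less:
  fixes x :: "'i \<Rightarrow> 'b::euclidean_space"
  assumes V: "finite V" and x: "\<And>i. i \<in> V \<Longrightarrow> norm (x i) = 1"
    and c: "\<And>i j. i \<in> V \<Longrightarrow> j \<in> V \<Longrightarrow> i \<noteq> j \<Longrightarrow> \<bar>x i \<bullet> x j\<bar> < 1"
    and u: "l \<in> V" "u l \<noteq> 0"
  shows "(\<Sum>i\<in>V. \<Sum>j\<in>V. u i * u j * sqrt (1 - (x i \<bullet> x j)\<^sup>2)) < (\<Sum>i\<in>V. u i)\<^sup>2"
proof -
  define C where "C i j = (x i \<bullet> x j)\<^sup>2" for i j
  have C0: "0 \<le> C i j" for i j by (simp add: C_def)
  have Cd: "C i i = 1" if "i \<in> V" for i
    using x[OF that] by (simp add: C_def flip: power2_norm_eq_inner)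
  have C1: "C i j < 1" if "i \<in> V" "j \<in> V" "i \<noteq> j" for i j
    using c[OF that] by (simp add: C_def abs_square_less_1)
  define Q where "Q k = (\<Sum>i\<in>V. \<Sum>j\<in>V. u i * u j * C i j ^ Suc k)" for k
  have Q0: "0 \<le> Q k" for k
    using sum_inner_power_nonneg[of u x "2 * Suc k" V] by (simp only: Q_def C_def power_mult)
  have sq: "(\<Sum>i\<in>V. \<Sum>j\<in>V. u i * u j * (if i = j then 1 else 0)) = (\<Sum>i\<in>V. (u i)\<^sup>2)"
    using V by (simp add: if_distrib sum.delta power2_eq_square cong: if_cong)
  have pos: "0 < (\<Sum>i\<in>V. (u i)\<^sup>2)"
    by (rule sum_pos2[OF V u(1)]) (use u in auto)
  have "Q \<longlonglongrightarrow> (\<Sum>i\<in>V. \<Sum>j\<in>V. u i * u j * (if i = j then 1 else 0))"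
    unfolding Q_def
  proof (intro tendsto_sum tendsto_mult tendsto_const)
    fix i j assume ij: "i \<in> V" "j \<in> V"
    show "(\<lambda>k. C i j ^ Suc k) \<longlonglongrightarrow> (if i = j then 1 else 0)"
    proof (cases "i = j")
      case True
      with ij show ?thesis by (simp add: Cd)
    next
      case False
      with C1[OF ij] C0[of i j] have "(\<lambda>k. C i j ^ k) \<longlonglongrightarrow> 0"
        by (intro LIMSEQ_realpow_zero)
      then show ?thesis
        using False by (simp add: LIMSEQ_Suc del: power_Suc)
    qed
  qed
  then have "\<forall>\<^sub>F k in sequentially. 0 < Q k"
    unfolding sq using pos by (rule order_tendstoD)
  \<comment> \<open>This fixed term provides the strict gap: all \<open>Q\<close> are nonnegative,
    so every longer partial sum is at least \<open>sqrt_coeff k * Q k\<close>.\<close>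
  then obtain k where k: "0 < Q k"
    by (auto simp: eventually_sequentially)
  define p where "p N z = (\<Sum>k<N. sqrt_coeff k * z ^ Suc k)" for N z
  \<comment> \<open>The diagonal gets its limit value 1 at once, as \<open>sqrt_coeff_sums\<close>
    needs \<open>z < 1\<close>. This can only increase the form, since \<open>u i * u i\<close> is
    nonnegative.\<close>
  define r where "r N i j = (if i = j then 1 else p N (C i j))" for N i j
  have lower: "sqrt_coeff k * Q k \<le> (\<Sum>i\<in>V. \<Sum>j\<in>V. u i * u j * r N i j)" if "k < N" for N
  proof -
    have "sqrt_coeff k * Q k \<le> (\<Sum>k<N. sqrt_coeff k * Q k)"
      by (rule member_le_sum) (use that in \<open>auto simp: Q0 sqrt_coeff_pos less_imp_le\<close>)
    also have "\<dots> = (\<Sum>k<N. \<Sum>i\<in>V. \<Sum>j\<in>V. u i * u j * (sqrt_coeff k * C i j ^ Suc k))"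
      by (simp only: Q_def sum_distrib_left) (simp only: mult_ac)
    also have "\<dots> = (\<Sum>i\<in>V. \<Sum>j\<in>V. u i * u j * p N (C i j))"
      by (simp only: p_def sum_distrib_left) (subst sum.swap, subst (2) sum.swap, rule refl)
    also have "\<dots> \<le> (\<Sum>i\<in>V. \<Sum>j\<in>V. u i * u j * r N i j)"
    proof (intro sum_mono)
      fix i j assume ij: "i \<in> V" "j \<in> V"
      have "p N (C i i) \<le> 1"
        using sum_sqrt_coeff_le_1[of N] by (simp add: p_def Cd ij)
      then show "u i * u j * p N (C i j) \<le> u i * u j * r N i j"
        by (auto simp: r_def intro: mult_left_le)
    qed
    finally show ?thesis .
  qed
  have "(\<lambda>N. \<Sum>i\<in>V. \<Sum>j\<in>V. u i * u j * r N i j)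
      \<longlonglongrightarrow> (\<Sum>i\<in>V. \<Sum>j\<in>V. u i * u j * (1 - sqrt (1 - C i j)))"
  proof (intro tendsto_sum tendsto_mult tendsto_const)
    fix i j assume ij: "i \<in> V" "j \<in> V"
    show "(\<lambda>N. r N i j) \<longlonglongrightarrow> 1 - sqrt (1 - C i j)"
      using sqrt_coeff_sums[OF C0 C1[OF ij]] ij
      by (cases "i = j") (auto simp: r_def Cd p_def sums_def)
  qed
  then have "sqrt_coeff k * Q k \<le> (\<Sum>i\<in>V. \<Sum>j\<in>V. u i * u j * (1 - sqrt (1 - C i j)))"
    by (rule Lim_bounded2[where N = "Suc k"]) (use lower in auto)
  also have "\<dots> = (\<Sum>i\<in>V. u i)\<^sup>2 - (\<Sum>i\<in>V. \<Sum>j\<in>V. u i * u j * sqrt (1 - C i j))"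
    by (simp add: power2_eq_square sum_product right_diff_distrib sum_subtractf)
  finally show ?thesis
    using mult_pos_pos[OF sqrt_coeff_pos[of k] k] by (simp add: C_def)
qed

section \<open>Lines at mutual distance 1\<close>

lemma cross_orthogonal_decomp:
  fixes a b w :: "real^3"
  assumes "cross3 a b \<bullet> w = 0" "cross3 a b \<noteq> 0"
  obtains s t where "w = s *\<^sub>R a + t *\<^sub>R b"
proof -
  let ?n = "cross3 a b"
  \<comment> \<open>Cramer's rule for the Gram matrix of \<open>a\<close> and \<open>b\<close>,
    whose determinant is \<open>?n \<bullet> ?n\<close>.\<close>
  have "(?n \<bullet> ?n) *\<^sub>R w = (?n \<bullet> w) *\<^sub>R ?n +
      (((a \<bullet> w) * (b \<bullet> b) - (b \<bullet> w) * (a \<bullet> b)) *\<^sub>R a +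
       ((b \<bullet> w) * (a \<bullet> a) - (a \<bullet> w) * (a \<bullet> b)) *\<^sub>R b)"
    unfolding vec_eq_iff forall_3
    by (simp add: cross3_simps)
  with assms(1) have W: "(?n \<bullet> ?n) *\<^sub>R w =
      ((a \<bullet> w) * (b \<bullet> b) - (b \<bullet> w) * (a \<bullet> b)) *\<^sub>R a +
      ((b \<bullet> w) * (a \<bullet> a) - (a \<bullet> w) * (a \<bullet> b)) *\<^sub>R b"
    by simp
  have "w = inverse (?n \<bullet> ?n) *\<^sub>R ((?n \<bullet> ?n) *\<^sub>R w)"
    using assms(2) by simp
  then show ?thesis
    unfolding W scaleR_add_right scaleR_scaleR by (rule that)
qed

lemma setdist_lines:
  assumes n: "cross3 (fst L) (fst M) \<noteq> 0"
  shows "setdist (line_points L) (line_points M) * norm (cross3 (fst L) (fst M)) =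
    \<bar>cross3 (fst L) (fst M) \<bullet> (snd L - snd M)\<bar>"
proof -
  define n d where "n = cross3 (fst L) (fst M)" and "d = n \<bullet> (snd L - snd M)"
  have n0: "n \<noteq> 0" using n by (simp add: n_def)
  then have nn: "n \<bullet> n = norm n * norm n" "norm n > 0"
    by (simp_all flip: power2_norm_eq_inner add: power2_eq_square)
  \<comment> \<open>Without its component along \<open>n\<close>, the difference of base points lies
    in the span of the two directions; \<open>s\<close> and \<open>t\<close> then locate the feet of
    the common perpendicular.\<close>
  have "n \<bullet> (snd L - snd M - (d / (n \<bullet> n)) *\<^sub>R n) = 0"
    using n0 by (simp add: inner_diff_right d_def)
  then obtain s t where st: "snd L - snd M - (d / (n \<bullet> n)) *\<^sub>R n = s *\<^sub>R fst L + t *\<^sub>R fst M"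
    using n cross_orthogonal_decomp unfolding n_def by metis
  have "setdist (line_points L) (line_points M)
      \<le> dist (- s *\<^sub>R fst L + snd L) (t *\<^sub>R fst M + snd M)"
    unfolding line_points_def by (rule setdist_le_dist) blast+
  also have "\<dots> = norm ((d / (n \<bullet> n)) *\<^sub>R n)"
    using st by (simp add: dist_norm algebra_simps)
  also have "\<dots> = \<bar>d\<bar> / norm n"
    using nn by (simp add: divide_simps abs_mult)
  finally have upper: "setdist (line_points L) (line_points M) \<le> \<bar>d\<bar> / norm n" .
  have "\<bar>d\<bar> / norm n \<le> setdist (line_points L) (line_points M)"
  proof (rule le_setdistI)
    fix p q assume "p \<in> line_points L" "q \<in> line_points M"
    then have "d = n \<bullet> (p - q)"
      by (auto simp: line_points_def d_def n_def inner_diff_right inner_add_right dot_cross_self)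
    then have "\<bar>d\<bar> \<le> norm n * dist p q"
      by (simp add: dist_norm Cauchy_Schwarz_ineq2)
    then show "\<bar>d\<bar> / norm n \<le> dist p q"
      using nn by (simp add: divide_simps mult.commute)
  qed (auto simp: line_points_def)
  with upper nn have "setdist (line_points L) (line_points M) * norm n = \<bar>d\<bar>"
    by (simp add: field_simps)
  then show ?thesis by (simp add: n_def d_def)
qed

text \<open>Distance and chirality merge into one equation. A general \<open>e\<close> makes room
  for relabelling, switching and negation.\<close>

definition sign_realization :: "'a set \<Rightarrow> ('a \<Rightarrow> dline) \<Rightarrow> ('a \<Rightarrow> 'a \<Rightarrow> real) \<Rightarrow> bool" where
  "sign_realization V L e \<longleftrightarrow>
     (\<forall>v\<in>V. norm (fst (L v)) = 1) \<and>
     (\<forall>v\<in>V. \<forall>w\<in>V. v \<noteq> w \<longrightarrow> cross3 (fst (L v)) (fst (L w)) \<noteq> 0 \<and>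
        cross3 (fst (L v)) (fst (L w)) \<bullet> (snd (L v) - snd (L w)) =
          e v w * norm (cross3 (fst (L v)) (fst (L w))))"

lemma realizable_imp_sign_realization:
  fixes G :: "'a graph"
  assumes "realizable G"
  obtains L where "sign_realization (fst G) L (\<lambda>v w. if {v, w} \<in> snd G then 1 else - 1)"
proof -
  obtain L :: "'a \<Rightarrow> dline" where dir: "\<forall>v\<in>fst G. directed_line (L v)"
    and L: "\<forall>v\<in>fst G. \<forall>w\<in>fst G. v \<noteq> w \<longrightarrow>
           \<not> parallel_lines (L v) (L w) \<and>
           setdist (line_points (L v)) (line_points (L w)) = 1 \<and>
           (chirality (L v) (L w) = 1 \<longleftrightarrow> {v, w} \<in> snd G)"
    using assms unfolding realizable_def by (elim exE conjE)
  have "sign_realization (fst G) L (\<lambda>v w. if {v, w} \<in> snd G then 1 else - 1)"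
    unfolding sign_realization_def
  proof (intro conjI ballI impI)
    fix v w assume vw: "v \<in> fst G" "w \<in> fst G" "v \<noteq> w"
    note L = L[rule_format, OF vw]
    have "norm (fst (L v)) = 1" "norm (fst (L w)) = 1"
      using dir vw by (auto simp: directed_line_def)
    then have "fst (L v) \<noteq> 0" "fst (L w) \<noteq> 0" by auto
    with L show n: "cross3 (fst (L v)) (fst (L w)) \<noteq> 0"
      unfolding cross_eq_0 collinear_lemma parallel_lines_def by blast
    define d where "d = cross3 (fst (L v)) (fst (L w)) \<bullet> (snd (L v) - snd (L w))"
    have d: "\<bar>d\<bar> = norm (cross3 (fst (L v)) (fst (L w)))"
      using setdist_lines[OF n] L by (simp add: d_def)
    moreover from d n have "d \<noteq> 0" by auto
    moreover have "sgn d = 1 \<longleftrightarrow> {v, w} \<in> snd G"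
      using L by (simp add: chirality_def d_def)
    ultimately have "d = (if {v, w} \<in> snd G then 1 else - 1) * norm (cross3 (fst (L v)) (fst (L w)))"
      by (cases d "0 :: real" rule: linorder_cases) simp_all
    then show "cross3 (fst (L v)) (fst (L w)) \<bullet> (snd (L v) - snd (L w)) =
        (if {v, w} \<in> snd G then 1 else - 1) * norm (cross3 (fst (L v)) (fst (L w)))"
      by (simp add: d_def)
  qed (use dir in \<open>auto simp: directed_line_def\<close>)
  then show ?thesis by (rule that)
qed

section \<open>Symmetries of sign patterns\<close>

lemma sign_realization_cong:
  assumes "sign_realization V L e"
    and "\<And>v w. v \<in> V \<Longrightarrow> w \<in> V \<Longrightarrow> v \<noteq> w \<Longrightarrow> e v w = e' v w"
  shows "sign_realization V L e'"
  using assms by (simp add: sign_realization_def)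

lemma sign_realization_relabel:
  assumes "sign_realization V L e" "inj_on f W" "f ` W \<subseteq> V"
  shows "sign_realization W (L \<circ> f) (\<lambda>v w. e (f v) (f w))"
  using assms by (simp add: sign_realization_def inj_on_eq_iff image_subset_iff)

text \<open>Reversing a line negates its cross products and keeps their norms; on graphs this is
  Seidel switching.\<close>

lemma sign_realization_switch:
  assumes "sign_realization V L e" and d: "\<And>v. \<bar>d v\<bar> = 1"
  shows "sign_realization V (\<lambda>v. (d v *\<^sub>R fst (L v), snd (L v))) (\<lambda>v w. d v * d w * e v w)"
proof -
  have "d v \<noteq> 0" for v using d[of v] by auto
  then show ?thesis
    using assms unfolding sign_realization_def
    by (simp add: cross_mult_left cross_mult_right abs_mult)
qed

text \<open>Reflection in the origin followed by reversal of all lines.\<close>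

lemma sign_realization_mirror:
  assumes "sign_realization V L e"
  shows "sign_realization V (\<lambda>v. (fst (L v), - snd (L v))) (\<lambda>v w. - e v w)"
proof -
  have "a \<bullet> (- p - - q) = - r \<longleftrightarrow> a \<bullet> (p - q) = r" for a p q :: "real^3" and r
    by (auto simp: inner_diff_right)
  with assms show ?thesis
    by (simp only: sign_realization_def fst_conv snd_conv mult_minus_left not_False_eq_True)
qed

text \<open>
  With the moments \<open>m\<^sub>v = y\<^sub>v \<times> x\<^sub>v\<close> the double sum equals
  \<open>2 (\<Sum>\<^sub>v u\<^sub>v x\<^sub>v) \<bullet> (\<Sum>\<^sub>v u\<^sub>v m\<^sub>v)\<close>.
\<close>

lemma sign_realization_isotropic:
  assumes "sign_realization V L e" "(\<Sum>v\<in>V. u v *\<^sub>R fst (L v)) = 0"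
  shows "(\<Sum>v\<in>V. \<Sum>w\<in>V. u v * u w * (e v w * norm (cross3 (fst (L v)) (fst (L w))))) = 0"
proof -
  define m where "m v = cross3 (snd (L v)) (fst (L v))" for v
  have "e v w * norm (cross3 (fst (L v)) (fst (L w))) = m v \<bullet> fst (L w) + fst (L v) \<bullet> m w"
    if "v \<in> V" "w \<in> V" for v w
  proof (cases "v = w")
    case True
    then show ?thesis by (simp add: m_def dot_cross_self)
  next
    case False
    have "cross3 a b \<bullet> (p - q) = cross3 p a \<bullet> b + a \<bullet> cross3 q b" for a b p q :: "real^3"
      by (simp add: cross3_simps)
    with False that assms(1) show ?thesis
      unfolding sign_realization_def m_def by metis
  qed
  then have "(\<Sum>v\<in>V. \<Sum>w\<in>V. u v * u w * (e v w * norm (cross3 (fst (L v)) (fst (L w))))) =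
      (\<Sum>v\<in>V. \<Sum>w\<in>V. (u v *\<^sub>R m v) \<bullet> (u w *\<^sub>R fst (L w))) +
      (\<Sum>v\<in>V. \<Sum>w\<in>V. (u v *\<^sub>R fst (L v)) \<bullet> (u w *\<^sub>R m w))"
    by (simp add: algebra_simps flip: sum.distrib)
  also have "(\<Sum>v\<in>V. \<Sum>w\<in>V. (u v *\<^sub>R m v) \<bullet> (u w *\<^sub>R fst (L w))) =
      (\<Sum>v\<in>V. u v *\<^sub>R m v) \<bullet> (\<Sum>w\<in>V. u w *\<^sub>R fst (L w))"
    by (simp only: inner_sum_left) (simp only: inner_sum_right)
  also have "(\<Sum>v\<in>V. \<Sum>w\<in>V. (u v *\<^sub>R fst (L v)) \<bullet> (u w *\<^sub>R m w)) =
      (\<Sum>v\<in>V. u v *\<^sub>R fst (L v)) \<bullet> (\<Sum>w\<in>V. u w *\<^sub>R m w)"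
    by (simp only: inner_sum_left) (simp only: inner_sum_right)
  finally show ?thesis by (simp add: assms(2))
qed

text \<open>The isotropic form of \<open>e\<close> is subtracted from the negative sine form. For
  signs \<open>e\<close>, only the pairs of sign -1 survive, with weight 2.\<close>

lemma sign_realization_defect_neg:
  assumes L: "sign_realization V L e" and V: "finite V"
    and u: "(\<Sum>v\<in>V. u v *\<^sub>R fst (L v)) = 0" "(\<Sum>v\<in>V. u v) = 0" "i \<in> V" "u i \<noteq> 0"
  shows "(\<Sum>v\<in>V. \<Sum>w\<in>V. (1 - e v w) * (norm (cross3 (fst (L v)) (fst (L w))) * (u v * u w))) < 0"
proof -
  let ?x = "\<lambda>v. fst (L v)"
  have norm1: "norm (?x v) = 1" if "v \<in> V" for v
    using L that by (simp add: sign_realization_def)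
  have sin: "(norm (cross3 (?x v) (?x w)))\<^sup>2 = 1 - (?x v \<bullet> ?x w)\<^sup>2" if "v \<in> V" "w \<in> V" for v w
    using norm_cross_dot[of "?x v" "?x w"] that by (simp add: norm1)
  have "(\<Sum>v\<in>V. \<Sum>w\<in>V. u v * u w * sqrt (1 - (?x v \<bullet> ?x w)\<^sup>2)) < (\<Sum>v\<in>V. u v)\<^sup>2"
  proof (rule sine_kernel_less[where l = i])
    show "norm (?x v) = 1" if "v \<in> V" for v by (rule norm1[OF that])
  next
    fix v w assume vw: "v \<in> V" "w \<in> V" "v \<noteq> w"
    then have "0 < (norm (cross3 (?x v) (?x w)))\<^sup>2"
      using L by (simp add: sign_realization_def)
    then show "\<bar>?x v \<bullet> ?x w\<bar> < 1"
      using vw by (simp add: sin flip: abs_square_less_1)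
  qed (use V u in auto)
  moreover have "sqrt (1 - (?x v \<bullet> ?x w)\<^sup>2) = norm (cross3 (?x v) (?x w))" if "v \<in> V" "w \<in> V" for v w
    using sin[OF that] by (metis norm_ge_zero real_sqrt_unique)
  ultimately have "(\<Sum>v\<in>V. \<Sum>w\<in>V. u v * u w * norm (cross3 (?x v) (?x w))) < 0"
    by (simp add: u(2))
  moreover have "(\<Sum>v\<in>V. \<Sum>w\<in>V. (1 - e v w) * (norm (cross3 (?x v) (?x w)) * (u v * u w))) =
      (\<Sum>v\<in>V. \<Sum>w\<in>V. u v * u w * norm (cross3 (?x v) (?x w))) -
      (\<Sum>v\<in>V. \<Sum>w\<in>V. u v * u w * (e v w * norm (cross3 (?x v) (?x w))))"
    by (simp add: algebra_simps flip: sum_subtractf)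
  ultimately show ?thesis
    by (simp only: sign_realization_isotropic[OF L u(1)] diff_zero)
qed

section \<open>Five test vectors\<close>

text \<open>The relation is indexed by \<open>I\<close> because vectors may repeat; a repetition
  \<open>z i = z j\<close> is itself a relation.\<close>

lemma linear_relation:
  fixes z :: "'i \<Rightarrow> 'b::euclidean_space"
  assumes "finite I" "DIM('b) < card I"
  obtains t where "(\<Sum>i\<in>I. t i *\<^sub>R z i) = 0" "\<exists>i\<in>I. t i \<noteq> 0"
proof (cases "inj_on z I")
  case True
  then have "dependent (z ` I)"
    using assms by (intro dependent_biggerset) (simp_all add: card_image)
  then obtain c where "(\<Sum>v\<in>z ` I. c v *\<^sub>R v) = 0" "\<exists>v\<in>z ` I. c v \<noteq> 0"
    using assms(1) by (auto simp: dependent_finite)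
  with True show ?thesis
    by (intro that[of "c \<circ> z"]) (simp_all add: sum.reindex)
next
  case False
  then obtain i j where ij: "i \<in> I" "j \<in> I" "i \<noteq> j" "z i = z j"
    by (auto simp: inj_on_def)
  have "(\<Sum>k\<in>I. ((if k = i then 1 else 0) - (if k = j then 1 else 0)) *\<^sub>R z k) = 0"
    using ij assms(1)
    by (simp add: scaleR_diff_left sum_subtractf if_distrib[of "\<lambda>r. r *\<^sub>R _"] cong: if_cong)
  with ij show ?thesis
    by (intro that[of "\<lambda>k. (if k = i then 1 else 0) - (if k = j then 1 else 0)"]) auto
qed

lemma linear_relation_5:
  fixes a b c d e :: "'b::euclidean_space"
  assumes "DIM('b) < 5"
  obtains t1 t2 t3 t4 t5 where
    "t1 *\<^sub>R a + t2 *\<^sub>R b + t3 *\<^sub>R c + t4 *\<^sub>R d + t5 *\<^sub>R e = 0"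
    "t1 \<noteq> 0 \<or> t2 \<noteq> 0 \<or> t3 \<noteq> 0 \<or> t4 \<noteq> 0 \<or> t5 \<noteq> 0"
proof -
  obtain t where "(\<Sum>i<5. t i *\<^sub>R ([a, b, c, d, e] ! i)) = 0" "\<exists>i\<in>{..<5::nat}. t i \<noteq> 0"
    by (rule linear_relation[of "{..<5::nat}" "\<lambda>i. [a, b, c, d, e] ! i"]) (use assms in auto)
  then show ?thesis
    by (intro that[of "t 0" "t 1" "t 2" "t 3" "t 4"])
      (auto simp: eval_nat_numeral less_Suc_eq)
qed

lemma norm_cross3_commute: "norm (cross3 a b) = norm (cross3 b a)"
  by (subst cross_skew) simp

lemma no_sign_realization_K5:
  "\<not> sign_realization {1..5::nat} L (\<lambda>v w. 1)"
proof
  assume L: "sign_realization {1..5} L (\<lambda>v w. 1)"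
  \<comment> \<open>Appending 1 to the direction joins both linear conditions on \<open>u\<close>
    into one relation in dimension 4.\<close>
  define z where "z v = (fst (L v), 1::real)" for v
  obtain t1 t2 t3 t4 t5 where
    t: "t1 *\<^sub>R z 1 + t2 *\<^sub>R z 2 + t3 *\<^sub>R z 3 + t4 *\<^sub>R z 4 + t5 *\<^sub>R z 5 = 0"
    and t0: "t1 \<noteq> 0 \<or> t2 \<noteq> 0 \<or> t3 \<noteq> 0 \<or> t4 \<noteq> 0 \<or> t5 \<noteq> 0"
    by (rule linear_relation_5[of "z 1" "z 2" "z 3" "z 4" "z 5"]) simp
  define u where "u = (\<lambda>_. 0)(1::nat := t1, 2 := t2, 3 := t3, 4 := t4, 5 := t5)"
  have V: "{1..5::nat} = {1,2,3,4,5}" by auto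
  have "\<exists>i\<in>{1..5}. u i \<noteq> 0"
    using t0 unfolding V by (auto simp: u_def)
  then obtain i where "i \<in> {1..5}" "u i \<noteq> 0" ..
  moreover have "(\<Sum>v\<in>{1..5}. u v *\<^sub>R fst (L v)) = 0" "(\<Sum>v\<in>{1..5}. u v) = 0"
    using t unfolding V by (simp_all add: u_def z_def zero_prod_def algebra_simps)
  ultimately show False
    using sign_realization_defect_neg[OF L, of u i] by simp
qed

text \<open>
  In the next two lemmas the test space is spanned by the unit vectors of an independent set
  of \<open>H\<close>, on which the weighted edge sum vanishes, and one vector that is orthogonal to all of
  them for that form and at which it is nonnegative. The coefficients \<open>\<alpha>, \<beta>, \<gamma>\<close> solve the orthogonality.
\<close>

lemma no_sign_realization_C5:
  "\<not> sign_realization {1..7::nat} L (\<lambda>v w. if {v, w} \<in> snd (cycle_graph 5) then - 1 else 1)"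
proof
  assume L: "sign_realization {1..7} L (\<lambda>v w. if {v, w} \<in> snd (cycle_graph 5) then - 1 else 1)"
  define s where "s v w = norm (cross3 (fst (L v)) (fst (L w)))" for v w
  have s: "0 < s v w" if "v \<in> {1..7}" "w \<in> {1..7}" "v \<noteq> w" for v w
    using L that by (simp add: sign_realization_def s_def)
  have sym: "s v w = s w v" for v w
    unfolding s_def by (rule norm_cross3_commute)
  define \<beta> \<gamma> where "\<beta> = s 2 3 / s 3 4" and "\<gamma> = s 1 2 / s 1 5"
  have \<beta>\<gamma>: "0 < \<beta>" "0 < \<gamma>" "s 3 4 * \<beta> = s 2 3" "s 1 5 * \<gamma> = s 1 2"
    using s[of 2 3] s[of 3 4] s[of 1 2] s[of 1 5] by (simp_all add: \<beta>_def \<gamma>_def)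
  define z where "z v = (fst (L v), 1::real)" for v
  \<comment> \<open>The independent set is 1, 3, 6, 7; the fifth vector lives on 2, 4, 5.\<close>
  obtain t1 t2 t3 t4 t5 where
    t: "t1 *\<^sub>R z 1 + t2 *\<^sub>R z 3 + t3 *\<^sub>R (\<beta> *\<^sub>R z 4 + \<gamma> *\<^sub>R z 5 - z 2) + t4 *\<^sub>R z 6 + t5 *\<^sub>R z 7 = 0"
    and t0: "t1 \<noteq> 0 \<or> t2 \<noteq> 0 \<or> t3 \<noteq> 0 \<or> t4 \<noteq> 0 \<or> t5 \<noteq> 0"
    by (rule linear_relation_5[of "z 1" "z 3" "\<beta> *\<^sub>R z 4 + \<gamma> *\<^sub>R z 5 - z 2" "z 6" "z 7"]) simp
  define u where "u = (\<lambda>_. 0)(1::nat := t1, 2 := - t3, 3 := t2, 4 := t3 * \<beta>, 5 := t3 * \<gamma>, 6 := t4, 7 := t5)"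
  have V: "{1..7::nat} = {1,2,3,4,5,6,7}" by auto
  have "\<exists>i\<in>{1..7}. u i \<noteq> 0"
    using t0 unfolding V by (auto simp: u_def)
  then obtain i where "i \<in> {1..7}" "u i \<noteq> 0" ..
  moreover have "(\<Sum>v\<in>{1..7}. u v *\<^sub>R fst (L v)) = 0" "(\<Sum>v\<in>{1..7}. u v) = 0"
    using t unfolding V by (simp_all add: u_def z_def zero_prod_def algebra_simps)
  ultimately have "(\<Sum>v\<in>{1..7}. \<Sum>w\<in>{1..7}.
      (1 - (if {v, w} \<in> snd (cycle_graph 5) then - 1 else 1)) * (s v w * (u v * u w))) < 0"
    unfolding s_def by (intro sign_realization_defect_neg[OF L, where i = i]) simp_all
  also have "(\<Sum>v\<in>{1..7}. \<Sum>w\<in>{1..7}.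
      (1 - (if {v, w} \<in> snd (cycle_graph 5) then - 1 else 1)) * (s v w * (u v * u w))) =
      4 * (s 1 2 * (u 1 * u 2) + s 2 3 * (u 2 * u 3) + s 3 4 * (u 3 * u 4) +
        s 4 5 * (u 4 * u 5) + s 1 5 * (u 1 * u 5))"
    unfolding V cycle_graph_5
    by (simp add: doubleton_eq_iff sym[of 2 "Suc 0"] sym[of 3 2] sym[of 4 3] sym[of 5 4] sym[of 5 "Suc 0"])
  \<comment> \<open>The edges at 1 and 3 cancel, leaving only the edge 45.\<close>
  also have "\<dots> = 4 * (s 4 5 * (\<beta> * \<gamma>) * t3\<^sup>2)"
    unfolding \<beta>\<gamma>(3,4)[symmetric] by (simp add: u_def algebra_simps power2_eq_square)
  finally show False
    using \<beta>\<gamma>(1,2) s[of 4 5] by (simp add: mult_less_0_iff)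
qed

lemma no_sign_realization_H7:
  "\<not> sign_realization {1..8::nat} L (\<lambda>v w. if {v, w} \<in> snd H7 then - 1 else 1)"
proof
  assume L: "sign_realization {1..8} L (\<lambda>v w. if {v, w} \<in> snd H7 then - 1 else 1)"
  define s where "s v w = norm (cross3 (fst (L v)) (fst (L w)))" for v w
  have s: "0 < s v w" if "v \<in> {1..8}" "w \<in> {1..8}" "v \<noteq> w" for v w
    using L that by (simp add: sign_realization_def s_def)
  have sym: "s v w = s w v" for v w
    unfolding s_def by (rule norm_cross3_commute)
  define \<alpha> \<beta> \<gamma> where "\<alpha> = s 4 7 / s 1 4" and "\<beta> = s 5 7 / s 2 5" and "\<gamma> = s 6 7 / s 3 6"
  have \<alpha>\<beta>\<gamma>: "0 < \<alpha>" "0 < \<beta>" "0 < \<gamma>"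
      "s 1 4 * \<alpha> = s 4 7" "s 2 5 * \<beta> = s 5 7" "s 3 6 * \<gamma> = s 6 7"
    using s[of 4 7] s[of 1 4] s[of 5 7] s[of 2 5] s[of 6 7] s[of 3 6]
    by (simp_all add: \<alpha>_def \<beta>_def \<gamma>_def)
  define z where "z v = (fst (L v), 1::real)" for v
  \<comment> \<open>The independent set is 4, 5, 6, 8; the fifth vector lives on the triangle 123
    and on 7.\<close>
  obtain t1 t2 t3 t4 t5 where
    t: "t1 *\<^sub>R z 4 + t2 *\<^sub>R z 5 + t3 *\<^sub>R z 6 +
      t4 *\<^sub>R (\<alpha> *\<^sub>R z 1 + \<beta> *\<^sub>R z 2 + \<gamma> *\<^sub>R z 3 - z 7) + t5 *\<^sub>R z 8 = 0"
    and t0: "t1 \<noteq> 0 \<or> t2 \<noteq> 0 \<or> t3 \<noteq> 0 \<or> t4 \<noteq> 0 \<or> t5 \<noteq> 0"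
    by (rule linear_relation_5[of "z 4" "z 5" "z 6" "\<alpha> *\<^sub>R z 1 + \<beta> *\<^sub>R z 2 + \<gamma> *\<^sub>R z 3 - z 7" "z 8"]) simp
  define u where "u = (\<lambda>_. 0)(1::nat := t4 * \<alpha>, 2 := t4 * \<beta>, 3 := t4 * \<gamma>,
    4 := t1, 5 := t2, 6 := t3, 7 := - t4, 8 := t5)"
  have V: "{1..8::nat} = {1,2,3,4,5,6,7,8}" by auto
  have "\<exists>i\<in>{1..8}. u i \<noteq> 0"
    using t0 unfolding V by (auto simp: u_def)
  then obtain i where "i \<in> {1..8}" "u i \<noteq> 0" ..
  moreover have "(\<Sum>v\<in>{1..8}. u v *\<^sub>R fst (L v)) = 0" "(\<Sum>v\<in>{1..8}. u v) = 0"
    using t unfolding V by (simp_all add: u_def z_def zero_prod_def algebra_simps)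
  ultimately have "(\<Sum>v\<in>{1..8}. \<Sum>w\<in>{1..8}.
      (1 - (if {v, w} \<in> snd H7 then - 1 else 1)) * (s v w * (u v * u w))) < 0"
    unfolding s_def by (intro sign_realization_defect_neg[OF L, where i = i]) simp_all
  also have "(\<Sum>v\<in>{1..8}. \<Sum>w\<in>{1..8}.
      (1 - (if {v, w} \<in> snd H7 then - 1 else 1)) * (s v w * (u v * u w))) =
      4 * (s 1 2 * (u 1 * u 2) + s 2 3 * (u 2 * u 3) + s 1 3 * (u 1 * u 3) +
        s 1 4 * (u 1 * u 4) + s 2 5 * (u 2 * u 5) + s 3 6 * (u 3 * u 6) +
        s 4 7 * (u 4 * u 7) + s 5 7 * (u 5 * u 7) + s 6 7 * (u 6 * u 7))"
    unfolding V H7_def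
    by (simp add: doubleton_eq_iff sym[of 2 "Suc 0"] sym[of 3 2] sym[of 3 "Suc 0"] sym[of 4 "Suc 0"] sym[of 5 2]
        sym[of 6 3] sym[of 7 4] sym[of 7 5] sym[of 7 6])
  \<comment> \<open>The edges at 4, 5 and 6 cancel, leaving the triangle with positive
    coefficients.\<close>
  also have "\<dots> = 4 * ((s 1 2 * (\<alpha> * \<beta>) + s 2 3 * (\<beta> * \<gamma>) + s 1 3 * (\<alpha> * \<gamma>)) * t4\<^sup>2)"
    unfolding \<alpha>\<beta>\<gamma>(4-6)[symmetric] by (simp add: u_def algebra_simps power2_eq_square)
  also have "0 \<le> \<dots>"
    using \<alpha>\<beta>\<gamma>(1-3) s[of 1 2] s[of 2 3] s[of 1 3]
    by (intro mult_nonneg_nonneg add_nonneg_nonneg) simp_all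
  finally show False by simp
qed

section \<open>The five graphs\<close>

lemma sign_realization_complete_graph_minus:
  assumes "realizable (complete_graph_minus n H)"
  obtains L where "sign_realization {1..n} L (\<lambda>v w. if {v, w} \<in> snd H then - 1 else 1)"
proof -
  obtain L where "sign_realization {1..n} L
      (\<lambda>v w. if {v, w} \<in> all_pairs {1..n} - snd H then 1 else - 1)"
    using realizable_imp_sign_realization[OF assms]
    by (auto simp: complete_graph_minus_def complete_graph_def)
  then have "sign_realization {1..n} L (\<lambda>v w. if {v, w} \<in> snd H then - 1 else 1)"
    by (rule sign_realization_cong) (simp add: all_pairs_iff)
  then show ?thesis by (rule that)
qed

lemma not_realizable_K5: "\<not> realizable (complete_graph 5)"
proof
  assume "realizable (complete_graph 5)"
  then obtain L where "sign_realization {1..5::nat} L (\<lambda>v w. if {v, w} \<in> all_pairs {1..5} then 1 else - 1)"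
    by (rule realizable_imp_sign_realization) (simp add: complete_graph_def)
  then have "sign_realization {1..5} L (\<lambda>v w. 1)"
    by (rule sign_realization_cong) (simp add: all_pairs_iff)
  with no_sign_realization_K5 show False by blast
qed

lemma not_realizable_K32: "\<not> realizable (complete_bipartite_graph 3 2)"
proof
  assume "realizable (complete_bipartite_graph 3 2)"
  moreover have "fst (complete_bipartite_graph 3 2) = {1..5}"
    by (simp add: complete_bipartite_graph_def)
  ultimately obtain L where L: "sign_realization {1..5} L
      (\<lambda>v w. if {v, w} \<in> snd (complete_bipartite_graph 3 2) then 1 else - 1)"
    using realizable_imp_sign_realization by metis
  define d :: "nat \<Rightarrow> real" where "d v = (if v \<le> 3 then 1 else - 1)" for v
  have edge: "{v, w} \<in> snd (complete_bipartite_graph 3 2) \<longleftrightarrow> (v \<le> 3) \<noteq> (w \<le> 3)"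
    if "v \<in> {1..5}" "w \<in> {1..5}" for v w
  proof -
    have "{v, w} \<in> snd (complete_bipartite_graph 3 2) \<longleftrightarrow>
        v \<in> {1..3} \<and> w \<in> {4..5} \<or> w \<in> {1..3} \<and> v \<in> {4..5}"
      by (simp add: complete_bipartite_graph_def doubleton_eq_iff) blast
    with that show ?thesis by auto
  qed
  have "\<bar>d v\<bar> = 1" for v
    by (simp add: d_def)
  from sign_realization_mirror[OF sign_realization_switch[OF L this]]
  have "sign_realization {1..5} (\<lambda>v. (d v *\<^sub>R fst (L v), - snd (L v))) (\<lambda>v w. 1)"
    unfolding fst_conv snd_conv by (rule sign_realization_cong) (simp add: edge d_def)
  with no_sign_realization_K5 show False by blast
qed

text \<open>
  Switching the vertices 2 and 5 turns \<open>H\<^sub>6\<close> plus an isolated vertex into the pentagon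
  2, 4, 3, 5, 7 plus the isolated vertices 1 and 6.
\<close>

lemma not_realizable_H6: "\<not> realizable (complete_graph_minus 7 H6)"
proof
  assume "realizable (complete_graph_minus 7 H6)"
  then obtain L where L: "sign_realization {1..7} L (\<lambda>v w. if {v, w} \<in> snd H6 then - 1 else 1)"
    by (rule sign_realization_complete_graph_minus)
  define d :: "nat \<Rightarrow> real" where "d v = (if v \<in> {2, 5} then - 1 else 1)" for v
  define f :: "nat \<Rightarrow> nat" where "f v = [2, 4, 3, 5, 7, 1, 6] ! (v - 1)" for v
  have V: "{1..7::nat} = {1,2,3,4,5,6,7}" by auto
  have d: "\<bar>d v\<bar> = 1" for v
    by (simp add: d_def)
  have inj: "inj_on f {1..7}"
    unfolding V by (simp add: f_def)
  have im: "f ` {1..7} \<subseteq> {1..7}"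
    unfolding V by (simp add: f_def)
  from sign_realization_relabel[OF sign_realization_switch[OF L d] inj im]
  have "sign_realization {1..7} ((\<lambda>v. (d v *\<^sub>R fst (L v), snd (L v))) \<circ> f)
      (\<lambda>v w. if {v, w} \<in> snd (cycle_graph 5) then - 1 else 1)"
  proof (rule sign_realization_cong)
    have "\<forall>v\<in>{1..7}. \<forall>w\<in>{1..7}. v \<noteq> w \<longrightarrow>
        d (f v) * d (f w) * (if {f v, f w} \<in> snd H6 then - 1 else 1) =
        (if {v, w} \<in> snd (cycle_graph 5) then - 1 else 1)"
      unfolding V by (simp add: d_def f_def H6_def cycle_graph_5 doubleton_eq_iff)
    then show "d (f v) * d (f w) * (if {f v, f w} \<in> snd H6 then - 1 else 1) =
        (if {v, w} \<in> snd (cycle_graph 5) then - 1 else 1)"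
      if "v \<in> {1..7}" "w \<in> {1..7}" "v \<noteq> w" for v w
      using that by blast
  qed
  with no_sign_realization_C5 show False by blast
qed

lemma not_realizable_complete_graph_minusI:
  assumes "\<And>L. \<not> sign_realization {1..n} L (\<lambda>v w. if {v, w} \<in> snd H then - 1 else 1)"
  shows "\<not> realizable (complete_graph_minus n H)"
  using assms by (blast elim: sign_realization_complete_graph_minus)

theorem theorem2:
  "\<not> realizable (complete_graph 5) \<and>
   \<not> realizable (complete_bipartite_graph 3 2) \<and>
   \<not> realizable (complete_graph_minus 7 (cycle_graph 5)) \<and>
   \<not> realizable (complete_graph_minus 7 H6) \<and>
   \<not> realizable (complete_graph_minus 8 H7)"
  by (intro conjI not_realizable_K5 not_realizable_K32 not_realizable_H6
      not_realizable_complete_graph_minusI no_sign_realization_C5 no_sign_realization_H7)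

end
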